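(* Let $R$ be a finite noncommutative ring and let $r\in R$. Then $\Gamma_R^r$ is not a lollipop graph.
   Context: Rings are associative and not assumed to have a unity. $[x,y]:=xy-yx$. The $r$-noncommuting graph $\Gamma_R^r$ is the simple undirected graph with vertex set $R$ in which two distinct vertices $x,y$ are adjacent if and only if $[x,y]\neq r$ and $[x,y]\neq -r$. A lollipop graph is a graph obtained by joining a complete graph $K_m$ ($m\geq 3$) to an end vertex of a path on $n\geq 1$ vertices by a single edge (a bridge). *)

theory Defs
  imports Graph_Theory.Kuratowski
begin

text \<open>
  The type class \<open>ring\<close> of HOL is exactly the class of associative rings that need not have a unity.
  Simple undirected graphs are symmetric, loop-free relations on a vertex set (the locale
  \<open>pair_graph\<close> of the digraph library), so every undirected edge \<open>{x, y}\<close> is represented by the two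
  arcs \<open>(x, y)\<close> and \<open>(y, x)\<close>.
\<close>

definition commutator :: "'a::ring \<Rightarrow> 'a \<Rightarrow> 'a" where
  "commutator x y = x * y - y * x"

definition noncommuting_graph :: "'a::ring \<Rightarrow> 'a pair_pre_digraph" where
  "noncommuting_graph r =
     \<lparr> pverts = UNIV,
       parcs = {(x, y). x \<noteq> y \<and> commutator x y \<noteq> r \<and> commutator x y \<noteq> - r} \<rparr>"

lemma pair_graph_noncommuting_graph:
  fixes r :: "'a::{ring,finite}"
  shows "pair_graph (noncommuting_graph r)"
proof -
  have swap: "commutator y x = r \<longleftrightarrow> commutator x y = - r" for x y r :: 'a
    unfolding commutator_def by (metis minus_diff_eq minus_minus)
  have "sym (parcs (noncommuting_graph r))"
    unfolding sym_def noncommuting_graph_def using swap[of _ _ r] by auto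
  then show ?thesis
    by unfold_locales (auto simp: noncommuting_graph_def symmetric_def)
qed

text \<open>The path running through the vertices of a list (of distinct vertices) in the given order.\<close>

definition path_graph :: "'a list \<Rightarrow> 'a pair_pre_digraph" where
  "path_graph vs =
     \<lparr> pverts = set vs,
       parcs = {(vs ! i, vs ! j) | i j.
                  i < length vs \<and> j < length vs \<and> (j = Suc i \<or> i = Suc j)} \<rparr>"

text \<open>
  The clique and the path are vertex-disjoint and are joined by the single edge from some clique
  vertex \<open>a\<close> to the end vertex \<open>hd vs\<close> of the path; the choice of the end is immaterial because the
  list may be reversed. As \<open>K\<close> and \<open>vs\<close> range over all complete graphs and paths on the vertex type,
  no separate closure under isomorphism is needed.
\<close>

definition lollipop_graph :: "'a pair_pre_digraph \<Rightarrow> bool" where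
  "lollipop_graph G \<longleftrightarrow>
     (\<exists>m n K vs a. m \<ge> 3 \<and> n \<ge> 1 \<and>
        complete_digraph m (with_proj K) \<and>
        distinct vs \<and> length vs = n \<and>
        pverts K \<inter> pverts (path_graph vs) = {} \<and>
        a \<in> pverts K \<and>
        G = \<lparr> pverts = pverts K \<union> pverts (path_graph vs),
              parcs = parcs K \<union> parcs (path_graph vs) \<union> {(a, hd vs), (hd vs, a)} \<rparr>)"

end

theory Submission
  imports Defs
begin

text \<open>
  If \<open>r = 0\<close>, the vertex \<open>0\<close> is isolated. If \<open>r \<noteq> 0\<close>, the vertex \<open>0\<close> is adjacent to every other
  vertex, which in a lollipop forces it to be the clique vertex carrying the path and the path to
  consist of a single vertex \<open>z\<close>. For any other clique vertex \<open>b\<close> the pair \<open>b, z\<close> is not adjacent,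
  hence neither is \<open>b, b + z\<close> because \<open>[b, b + z] = [b, z]\<close>; but \<open>b + z\<close> also lies in the clique.
\<close>

lemma commutator_zero_left [simp]: "commutator 0 y = 0"
  and commutator_zero_right [simp]: "commutator x 0 = 0"
  by (simp_all add: commutator_def)

lemma commutator_self_add: "commutator x (x + y) = commutator x y"
  by (simp add: commutator_def algebra_simps)

lemma arc_noncommuting_graph_iff:
  "(x, y) \<in> parcs (noncommuting_graph r) \<longleftrightarrow>
     x \<noteq> y \<and> commutator x y \<noteq> r \<and> commutator x y \<noteq> - r"
  by (simp add: noncommuting_graph_def)

lemma pverts_path_graph [simp]: "pverts (path_graph vs) = set vs"
  by (simp add: path_graph_def)

lemma parcs_path_graph_subset: "parcs (path_graph vs) \<subseteq> set vs \<times> set vs"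
  by (auto simp: path_graph_def)

text \<open>The predecessor in the list is a neighbour. The head is excluded because on a one-vertex
  path its only neighbour lies across the bridge.\<close>

lemma arc_into_path_vertex:
  assumes "v \<in> set vs" "v \<noteq> hd vs"
  shows "\<exists>u. (u, v) \<in> parcs (path_graph vs)"
proof -
  obtain i where i: "i < length vs" "v = vs ! i"
    using assms(1) by (metis in_set_conv_nth)
  with assms obtain j where "i = Suc j"
    by (cases i) (auto simp: hd_conv_nth)
  with i have "j < length vs" "Suc j < length vs" "v = vs ! Suc j"
    by simp_all
  then have "(vs ! j, v) \<in> parcs (path_graph vs)"
    unfolding path_graph_def pair_pre_digraph.select_convs by blast
  then show ?thesis ..
qed

theorem proposition2p4:
  fixes r :: "'a::{ring,finite}"
  assumes noncommutative: "\<exists>x y :: 'a. x * y \<noteq> y * x"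
  shows "\<not> lollipop_graph (noncommuting_graph r)"
proof
  let ?A = "parcs (noncommuting_graph r)"
  assume "lollipop_graph (noncommuting_graph r)"
  then obtain m K vs and a :: 'a where m: "m \<ge> 3" and vs: "length vs \<ge> 1"
    and complete: "complete_digraph m (with_proj K)"
    and disj: "pverts K \<inter> set vs = {}" and a: "a \<in> pverts K"
    and G: "noncommuting_graph r =
       \<lparr> pverts = pverts K \<union> set vs,
         parcs = parcs K \<union> parcs (path_graph vs) \<union> {(a, hd vs), (hd vs, a)} \<rparr>"
    unfolding lollipop_graph_def pverts_path_graph by blast
  have V: "pverts K \<union> set vs = UNIV"
    using arg_cong[OF G, of pverts] by (simp add: noncommuting_graph_def)
  have A: "?A = parcs K \<union> parcs (path_graph vs) \<union> {(a, hd vs), (hd vs, a)}"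
    using G by simp
  have K: "parcs K = {(u, v). u \<in> pverts K \<and> v \<in> pverts K \<and> u \<noteq> v}"
    and card_K: "card (pverts K) = m"
    using complete by (auto simp: complete_digraph_pair_def)
  have hd: "hd vs \<in> set vs" using vs by (cases vs) auto
  have "card (pverts K - {a}) \<noteq> 0"
    using m a card_K by simp
  then obtain b where b: "b \<in> pverts K" "b \<noteq> a"
    by (metis Diff_iff card.empty ex_in_conv singletonI)
  \<comment> \<open>Clique arcs and path arcs stay within their disjoint vertex sets, so only the
    bridge crosses.\<close>
  have bridge: "x = a \<and> y = hd vs" if "(x, y) \<in> ?A" "x \<in> pverts K" "y \<in> set vs" for x y
    using that A K disj hd parcs_path_graph_subset[of vs] by auto
  have "\<exists>u. (u, 0) \<in> ?A"
  proof (cases "0 \<in> pverts K")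
    case True
    then show ?thesis using A K a b by (cases "0 = a") auto
  next
    case False
    then have "0 \<in> set vs" using V by blast
    then show ?thesis using A arc_into_path_vertex[of 0 vs] by (cases "0 = hd vs") auto
  qed
  then have "r \<noteq> 0" by (auto simp: arc_noncommuting_graph_iff)
  then have zero: "(0, y) \<in> ?A" "(y, 0) \<in> ?A" if "y \<noteq> 0" for y
    using that by (auto simp: arc_noncommuting_graph_iff)
  \<comment> \<open>Were \<open>0\<close> on the path, the arc from \<open>b\<close> to
    \<open>0\<close> would cross, forcing \<open>b = a\<close>.\<close>
  have "0 \<in> pverts K"
    using bridge[of b 0] zero(2)[of b] b V by blast
  have nonzero: "y \<noteq> 0" if "y \<in> set vs" for y
    using that \<open>0 \<in> pverts K\<close> disj by auto
  have "a = 0"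
    using bridge[OF zero(1)[OF nonzero[OF hd]] \<open>0 \<in> pverts K\<close> hd] by simp
  have path: "y = hd vs" if "y \<in> set vs" for y
    using bridge[OF zero(1)[OF nonzero[OF that]] \<open>0 \<in> pverts K\<close> that] by simp
  define z where "z = hd vs"
  have "(b, z) \<notin> ?A" "b \<noteq> z" "z \<noteq> 0"
    using bridge b hd disj nonzero by (auto simp: z_def)
  \<comment> \<open>Since \<open>b \<noteq> z\<close>, the missing arc means that the commutator of
    \<open>b\<close> and \<open>z\<close> is \<open>r\<close> or \<open>- r\<close>.\<close>
  then have "(b, b + z) \<notin> ?A"
    by (simp add: arc_noncommuting_graph_iff commutator_self_add)
  \<comment> \<open>Otherwise \<open>b + z\<close> is the only path vertex \<open>z\<close>, so
    \<open>b = 0 = a\<close>.\<close>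
  moreover have "b + z \<in> pverts K"
    using path[of "b + z"] b \<open>a = 0\<close> V by (auto simp: z_def)
  then have "(b, b + z) \<in> ?A"
    using A K b \<open>z \<noteq> 0\<close> by simp
  ultimately show False by contradiction
qed

end
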